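(* For all $c>0$, and infinitely many integers $n$, there is a tournament $G$ with $n$ vertices, and a blockade $\mathcal{B}$ in $V(G)$ of length at least $1/c$, such that $G$ has no pure pair of order at least $cW(\mathcal{B})$, and there is no $\mathcal{B}$-rainbow copy in $G$ of either of $D_5, P_7^-$. Consequently $D_5$ and $P_7^-$ do not have the RSEH-property.
   Context: A tournament is a finite loopless digraph such that for every pair $u,v$ of distinct vertices exactly one of $uv,vu$ is an edge; an edge $uv$ is directed from $u$ to $v$. A pure pair in a tournament $G$ is an ordered pair $(A,B)$ of disjoint subsets of $V(G)$ such that $ab\in E(G)$ for all $a\in A,b\in B$; its order is $\min(|A|,|B|)$. A blockade in a set $V$ is a family $\mathcal{B}=(B_i:i\in I)$ of pairwise disjoint nonempty subsets (blocks) of $V$, where $I$ is a finite set of integers. Its length is $|I|$, and its width $W(\mathcal{B})$ is $\min_{i\in I}|B_i|$. A blockade in a tournament means a blockade in its vertex set. A copy in $G$ of a tournament $H$ is a subtournament of $G$ isomorphic to $H$; it is $\mathcal{B}$-rainbow if each of its vertices belongs to some block of $\mathcal{B}$ and no two of its vertices belong to the same block. A tournament $H$ has the rainbow strong EH-property (RSEH-property) if there exists $c$ with $0<c<1$ such that if $\mathcal{B}$ is a blockade of length at least $1/c$ in a tournament $G$, and there is no $\mathcal{B}$-rainbow copy of $H$ in $G$, then there is a pure pair in $G$ of order at least $cW(\mathcal{B})$. $D_5$ is the (unique up to isomorphism) tournament with five vertices in which every vertex has outdegree two. $P_7$ is the tournament with vertex set $\{1,\dots,7\}$ in which there is an edge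 from $i$ to $j$ if and only if $j-i$ is congruent to $1$, $2$ or $4$ modulo $7$; $P_7^-$ is obtained from $P_7$ by deleting one vertex (up to isomorphism it does not matter which). *)

theory Defs
  imports Complex_Main "HOL-Library.Disjoint_Sets" "Graph_Theory.Graph_Theory"
begin

text \<open>
  The locale \<^locale>\<open>digraph\<close> comprises finiteness, looplessness and the absence of parallel
  arcs; \<open>u \<rightarrow>\<^bsub>G\<^esub> v\<close> states that \<open>uv\<close> is an edge. The null tournament is allowed.
\<close>

definition tournament :: "('a, 'b) pre_digraph \<Rightarrow> bool" where
  "tournament G \<longleftrightarrow> digraph G \<and>
     (\<forall>u \<in> verts G. \<forall>v \<in> verts G. u \<noteq> v \<longrightarrow> (u \<rightarrow>\<^bsub>G\<^esub> v) \<noteq> (v \<rightarrow>\<^bsub>G\<^esub> u))"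

definition pure_pair :: "('a, 'b) pre_digraph \<Rightarrow> 'a set \<Rightarrow> 'a set \<Rightarrow> bool" where
  "pure_pair G A B \<longleftrightarrow> A \<subseteq> verts G \<and> B \<subseteq> verts G \<and> A \<inter> B = {} \<and>
     (\<forall>a \<in> A. \<forall>b \<in> B. a \<rightarrow>\<^bsub>G\<^esub> b)"

definition pair_order :: "'a set \<Rightarrow> 'a set \<Rightarrow> nat" where
  "pair_order A B = min (card A) (card B)"

text \<open>
  A blockade \<open>(B\<^sub>i : i \<in> I)\<close> is represented by its index set \<open>I\<close> and a function \<open>B\<close> whose
  values outside \<open>I\<close> are irrelevant.
\<close>

definition blockade :: "'a set \<Rightarrow> int set \<Rightarrow> (int \<Rightarrow> 'a set) \<Rightarrow> bool" where
  "blockade V I B \<longleftrightarrow> finite I \<and> disjoint_family_on B I \<and> (\<forall>i \<in> I. B i \<noteq> {} \<and> B i \<subseteq> V)"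

definition blockade_length :: "int set \<Rightarrow> nat" where
  "blockade_length I = card I"

text \<open>The width is only meaningful for nonempty \<open>I\<close>.\<close>

definition blockade_width :: "int set \<Rightarrow> (int \<Rightarrow> 'a set) \<Rightarrow> nat" where
  "blockade_width I B = Min ((\<lambda>i. card (B i)) ` I)"

text \<open>A subtournament of a tournament is the same as an induced subgraph.\<close>

definition is_copy :: "('a, 'b) pre_digraph \<Rightarrow> ('c, 'd) pre_digraph \<Rightarrow> ('a, 'b) pre_digraph \<Rightarrow> bool" where
  "is_copy K H G \<longleftrightarrow> induced_subgraph K G \<and> digraph_iso H K"

definition rainbow :: "int set \<Rightarrow> (int \<Rightarrow> 'a set) \<Rightarrow> ('a, 'b) pre_digraph \<Rightarrow> bool" where
  "rainbow I B K \<longleftrightarrow> verts K \<subseteq> (\<Union>i \<in> I. B i) \<and>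
     (\<forall>i \<in> I. \<forall>u \<in> verts K \<inter> B i. \<forall>v \<in> verts K \<inter> B i. u = v)"

definition has_rainbow_copy ::
  "('c, 'd) pre_digraph \<Rightarrow> ('a, 'b) pre_digraph \<Rightarrow> int set \<Rightarrow> (int \<Rightarrow> 'a set) \<Rightarrow> bool" where
  "has_rainbow_copy H G I B \<longleftrightarrow> (\<exists>K. is_copy K H G \<and> rainbow I B K)"

text \<open>
  Every (finite) tournament is isomorphic to one whose vertices are natural numbers and whose
  arcs are pairs of vertices, so it suffices to let \<open>G\<close> range over these.
\<close>

definition RSEH :: "('c, 'd) pre_digraph \<Rightarrow> bool" where
  "RSEH H \<longleftrightarrow> (\<exists>c::real. 0 < c \<and> c < 1 \<and>
     (\<forall>(G :: nat pair_pre_digraph) I B.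
        tournament G \<longrightarrow> blockade (verts G) I B \<longrightarrow> real (blockade_length I) \<ge> 1 / c \<longrightarrow>
        \<not> has_rainbow_copy H G I B \<longrightarrow>
        (\<exists>X Y. pure_pair G X Y \<and> real (pair_order X Y) \<ge> c * real (blockade_width I B))))"

text \<open>
  The lemma \<open>D5_characterization\<close> below shows that this is, up to isomorphism, the only
  tournament with five vertices in which every vertex has outdegree two.
\<close>

definition D5 :: "int pair_pre_digraph" where
  "D5 = \<lparr> pverts = {1..5},
          parcs = {(i, j). i \<in> {1..5} \<and> j \<in> {1..5} \<and> (j - i) mod 5 \<in> {1, 2}} \<rparr>"

definition P7 :: "int pair_pre_digraph" where
  "P7 = \<lparr> pverts = {1..7},
          parcs = {(i, j). i \<in> {1..7} \<and> j \<in> {1..7} \<and> (j - i) mod 7 \<in> {1, 2, 4}} \<rparr>"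

text \<open>By the lemma \<open>P7_minus_iso\<close> below, the choice of the deleted vertex is immaterial.\<close>

definition P7_minus :: "(int, int \<times> int) pre_digraph" where
  "P7_minus = pre_digraph.del_vert P7 7"

lemma digraph_isoI:
  fixes G :: "('a, 'b) pre_digraph" and H :: "('c, 'd) pre_digraph"
  assumes G: "digraph G" and H: "digraph H" and f: "bij_betw f (verts G) (verts H)"
    and e: "\<And>u v. u \<in> verts G \<Longrightarrow> v \<in> verts G \<Longrightarrow> u \<rightarrow>\<^bsub>G\<^esub> v \<longleftrightarrow> f u \<rightarrow>\<^bsub>H\<^esub> f v"
  shows "digraph_iso G H"
proof -
  interpret G: digraph G by fact
  interpret H: digraph H by fact
  define g where "g a = the_inv_into (arcs H) (arc_to_ends H) (f (tail G a), f (head G a))" for a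
  have injH: "inj_on (arc_to_ends H) (arcs H)" by (rule H.inj_on_arc_to_ends)
  have fi: "inj_on f (verts G)" and fs: "f ` verts G = verts H"
    using f by (auto simp: bij_betw_def)
  have im: "(f (tail G a), f (head G a)) \<in> arc_to_ends H ` arcs H" if "a \<in> arcs G" for a
  proof -
    have "tail G a \<rightarrow>\<^bsub>G\<^esub> head G a" using that by (auto simp: arcs_ends_conv)
    then have "f (tail G a) \<rightarrow>\<^bsub>H\<^esub> f (head G a)" using e that by auto
    then show ?thesis by (simp add: arcs_ends_def)
  qed
  have g1: "g a \<in> arcs H" if "a \<in> arcs G" for a
    unfolding g_def by (rule the_inv_into_into[OF injH im[OF that]]) simp
  have g2: "arc_to_ends H (g a) = (f (tail G a), f (head G a))" if "a \<in> arcs G" for a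
    unfolding g_def by (rule f_the_inv_into_f[OF injH im[OF that]])
  have gi: "inj_on g (arcs G)"
  proof (rule inj_onI)
    fix a b assume ab: "a \<in> arcs G" "b \<in> arcs G" "g a = g b"
    then have "f (tail G a) = f (tail G b)" "f (head G a) = f (head G b)"
      using g2[of a] g2[of b] by auto
    then have "arc_to_ends G a = arc_to_ends G b"
      using ab fi by (auto simp: arc_to_ends_def dest: inj_onD)
    then show "a = b" using ab G.no_multi_arcs by blast
  qed
  have gs: "arcs H \<subseteq> g ` arcs G"
  proof
    fix b assume b: "b \<in> arcs H"
    obtain u v where uv: "u \<in> verts G" "v \<in> verts G" "f u = tail H b" "f v = head H b"
      using b fs by (metis H.head_in_verts H.tail_in_verts imageE)
    have "f u \<rightarrow>\<^bsub>H\<^esub> f v" using b uv by (auto simp: arcs_ends_conv)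
    then have "u \<rightarrow>\<^bsub>G\<^esub> v" using e uv by auto
    then obtain a where a: "a \<in> arcs G" "tail G a = u" "head G a = v" by blast
    have "arc_to_ends H (g a) = arc_to_ends H b" using g2[OF a(1)] a uv by (simp add: arc_to_ends_def)
    then have "g a = b" using H.no_multi_arcs g1[OF a(1)] b by blast
    then show "b \<in> g ` arcs G" using a by blast
  qed
  define h where "h = \<lparr> iso_verts = f, iso_arcs = g, iso_head = head H, iso_tail = tail H \<rparr>"
  have "pre_digraph.digraph_isomorphism G h"
    unfolding pre_digraph.digraph_isomorphism_def
    using g2 gi fi G.wf_digraph by (auto simp: h_def arc_to_ends_def)
  moreover have "H = app_iso h G"
    using gs g1 fs by (auto simp: app_iso_def h_def intro!: pre_digraph.equality)
  ultimately show ?thesis unfolding digraph_iso_def by blast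
qed

lemma digraph_with_projI:
  assumes "finite V" "\<And>u v. (u, v) \<in> E \<Longrightarrow> u \<in> V \<and> v \<in> V \<and> u \<noteq> v"
  shows "digraph (with_proj \<lparr> pverts = V, parcs = E \<rparr>)"
proof -
  have "E \<subseteq> V \<times> V" using assms by auto
  then have "finite E" using assms finite_subset by blast
  then show ?thesis using assms by unfold_locales (auto simp: arc_to_ends_def)
qed

lemma atLeastAtMost_int_5: "{1..5::int} = {1, 2, 3, 4, 5}"
  and atLeastAtMost_int_7: "{1..7::int} = {1, 2, 3, 4, 5, 6, 7}"
  by auto

lemma D5_simps:
  "verts D5 = {1..5}"
  "i \<rightarrow>\<^bsub>D5\<^esub> j \<longleftrightarrow> i \<in> {1..5} \<and> j \<in> {1..5} \<and> (j - i) mod 5 \<in> {1, 2}"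
  by (auto simp: D5_def)

lemma P7_simps:
  "verts P7 = {1..7}"
  "i \<rightarrow>\<^bsub>P7\<^esub> j \<longleftrightarrow> i \<in> {1..7} \<and> j \<in> {1..7} \<and> (j - i) mod 7 \<in> {1, 2, 4}"
  by (auto simp: P7_def)

lemma tournament_D5: "tournament D5"
proof -
  have "digraph D5" unfolding D5_def by (rule digraph_with_projI) auto
  moreover have "\<forall>u \<in> verts D5. \<forall>v \<in> verts D5. u \<noteq> v \<longrightarrow> (u \<rightarrow>\<^bsub>D5\<^esub> v) \<noteq> (v \<rightarrow>\<^bsub>D5\<^esub> u)"
    unfolding D5_simps atLeastAtMost_int_5 by simp
  ultimately show ?thesis unfolding tournament_def by blast
qed

lemma tournament_P7: "tournament P7"
proof -
  have "digraph P7" unfolding P7_def by (rule digraph_with_projI) auto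
  moreover have "\<forall>u \<in> verts P7. \<forall>v \<in> verts P7. u \<noteq> v \<longrightarrow> (u \<rightarrow>\<^bsub>P7\<^esub> v) \<noteq> (v \<rightarrow>\<^bsub>P7\<^esub> u)"
    unfolding P7_simps atLeastAtMost_int_7 by simp
  ultimately show ?thesis unfolding tournament_def by blast
qed

lemma out_degree_conv_card:
  assumes "digraph H"
  shows "out_degree H v = card {w \<in> verts H. v \<rightarrow>\<^bsub>H\<^esub> w}"
proof -
  interpret digraph H by fact
  have "bij_betw (head H) (out_arcs H v) {w \<in> verts H. v \<rightarrow>\<^bsub>H\<^esub> w}"
    unfolding bij_betw_def
  proof
    show "inj_on (head H) (out_arcs H v)"
      by (rule inj_onI) (auto intro!: no_multi_arcs simp: arc_to_ends_def)
    show "head H ` out_arcs H v = {w \<in> verts H. v \<rightarrow>\<^bsub>H\<^esub> w}"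
      by (auto simp: arcs_ends_conv out_arcs_def image_iff)
  qed
  then show ?thesis unfolding out_degree_def by (rule bij_betw_same_card)
qed

lemma D5_regular:
  assumes "v \<in> verts D5"
  shows "out_degree D5 v = 2"
proof -
  have "digraph D5" using tournament_D5 by (simp add: tournament_def)
  moreover have "{w \<in> verts D5. v \<rightarrow>\<^bsub>D5\<^esub> w} =
      (if v = 4 then {5, 1} else if v = 5 then {1, 2} else {v + 1, v + 2})"
    using assms unfolding D5_simps atLeastAtMost_int_5 by (elim insertE emptyE) auto
  ultimately show ?thesis by (simp add: out_degree_conv_card)
qed

lemma D5_characterization:
  fixes H :: "('a, 'b) pre_digraph"
  assumes T: "tournament H" and c5: "card (verts H) = 5"
    and deg: "\<And>v. v \<in> verts H \<Longrightarrow> out_degree H v = 2"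
  shows "digraph_iso D5 H"
proof -
  define R where "R u v \<longleftrightarrow> u \<rightarrow>\<^bsub>H\<^esub> v" for u v
  define N where "N v = {w \<in> verts H. R v w}" for v
  have dig: "digraph H" using T by (simp add: tournament_def)
  interpret H: digraph H by fact
  have fin: "finite (verts H)" by simp
  have N2: "card (N v) = 2" if "v \<in> verts H" for v
    using deg[OF that] out_degree_conv_card[OF dig, of v] by (simp add: N_def R_def)
  have irr: "\<not> R v v" for v unfolding R_def using H.adj_not_same by blast
  have tour: "R u v \<longleftrightarrow> \<not> R v u" if "u \<in> verts H" "v \<in> verts H" "u \<noteq> v" for u v
    using T that unfolding tournament_def R_def by blast
  have full: "\<not> R v z" if "v \<in> verts H" "x \<noteq> y" "R v x" "R v y" "x \<in> verts H" "y \<in> verts H"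
    "z \<noteq> x" "z \<noteq> y" for v x y z
  proof
    assume z: "R v z"
    then have "z \<in> verts H" unfolding R_def using H.adj_in_verts by blast
    then have "{x, y, z} \<subseteq> N v" using that z by (auto simp: N_def)
    then have "card {x, y, z} \<le> card (N v)" using fin by (intro card_mono) (auto simp: N_def)
    then show False using that N2[of v] by auto
  qed
  obtain v where v: "v \<in> verts H" using c5 by (metis card.empty equals0I zero_neq_numeral)
  obtain a' b' where ab': "N v = {a', b'}" "a' \<noteq> b'" using N2[OF v] by (auto simp: card_2_iff)
  obtain a b where ab: "N v = {a, b}" "a \<noteq> b" "R a b"
    using ab' tour[of a' b'] by (cases "R a' b'") (auto simp: N_def)
  have abV: "a \<in> verts H" "b \<in> verts H" "R v a" "R v b" using ab by (auto simp: N_def)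
  have ne: "v \<noteq> a" "v \<noteq> b" using abV irr by auto
  have "card (verts H - {v, a, b}) = 2"
    using c5 v abV ne ab(2) by (simp add: card_Diff_subset)
  then obtain c' d' where cd': "verts H - {v, a, b} = {c', d'}" "c' \<noteq> d'" by (auto simp: card_2_iff)
  obtain c d where cd: "verts H - {v, a, b} = {c, d}" "c \<noteq> d" "R c d"
    using cd' tour[of c' d'] by (cases "R c' d'") auto
  have cdV: "c \<in> verts H" "d \<in> verts H" "c \<notin> {v, a, b}" "d \<notin> {v, a, b}" using cd by auto
  have V: "verts H = {v, a, b, c, d}" using cd v abV by auto
  have 1: "\<not> R v c" "\<not> R v d" using ab cdV by (auto simp: N_def)
  have 2: "R c v" "R d v" using 1 tour[of c v] tour[of d v] cdV v by blast+
  have 3: "\<not> R c a" "\<not> R c b" using full[of c v d a] full[of c v d b] 2 cd(2,3) cdV abV v ne by blast+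
  have 4: "R a c" "R b c" using 3 tour[of a c] tour[of b c] cdV abV by blast+
  have 5: "\<not> R a d" using full[of a b c d] 4 ab(3) cd(2) cdV abV by blast
  have 6: "R d a" using 5 tour[of d a] cdV abV by blast
  have 7: "\<not> R d b" using full[of d v a b] 2 6 cdV abV v ne ab(2) by blast
  have 8: "R b d" using 7 tour[of b d] cdV abV by blast
  have 9: "\<not> R a v" "\<not> R b v" "\<not> R b a" "\<not> R d c"
    using tour[of v a] tour[of v b] tour[of a b] tour[of c d] abV cdV v ne ab(2,3) cd(2,3) by blast+
  define f :: "int \<Rightarrow> 'a" where
    "f i = (if i = 1 then v else if i = 2 then a else if i = 3 then b else if i = 4 then c else d)" for i
  show ?thesis
  proof (rule digraph_isoI[where f = f])
    show "digraph D5" using tournament_D5 by (simp add: tournament_def)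
    show "digraph H" by fact
    show "bij_betw f (verts D5) (verts H)"
      unfolding bij_betw_def V D5_simps atLeastAtMost_int_5
      using ne ab(2) cd(2) cdV by (auto simp: f_def inj_on_def)
    fix i j assume "i \<in> verts D5" "j \<in> verts D5"
    then show "i \<rightarrow>\<^bsub>D5\<^esub> j \<longleftrightarrow> f i \<rightarrow>\<^bsub>H\<^esub> f j"
      unfolding R_def[symmetric] D5_simps atLeastAtMost_int_5
      by (elim insertE emptyE) (use 1 2 3 4 5 6 7 8 9 abV(3,4) ab(3) cd(3) irr in \<open>simp_all add: f_def\<close>)
  qed
qed

lemma P7_minus_iso:
  assumes "k \<in> {1..7}"
  shows "digraph_iso P7_minus (pre_digraph.del_vert P7 k)"
proof -
  interpret P7: digraph P7 using tournament_P7 by (simp add: tournament_def)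
  have dig: "digraph (pre_digraph.del_vert P7 l)" for l
  proof -
    have "finite (arcs (pre_digraph.del_vert P7 l))"
      by (rule finite_subset[OF _ P7.finite_arcs]) (auto simp: pre_digraph.del_vert_def)
    then show ?thesis
      by unfold_locales (auto simp: pre_digraph.del_vert_def arc_to_ends_def P7_def)
  qed
  have vs: "verts (pre_digraph.del_vert P7 l) = {1..7} - {l}" for l
    by (simp add: pre_digraph.del_vert_def P7_def)
  have es: "i \<rightarrow>\<^bsub>pre_digraph.del_vert P7 l\<^esub> j \<longleftrightarrow>
      i \<noteq> l \<and> j \<noteq> l \<and> i \<in> {1..7} \<and> j \<in> {1..7} \<and> (j - i) mod 7 \<in> {1, 2, 4}" for i j l
    by (auto simp: pre_digraph.del_vert_def P7_def arcs_ends_conv image_iff)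
  define f where "f i = (i + k - 1) mod 7 + 1" for i :: int
  show ?thesis
    unfolding P7_minus_def
  proof (rule digraph_isoI[where f = f, OF dig dig])
    have v6: "{1..7} - {7::int} = {1, 2, 3, 4, 5, 6}" by auto
    have k: "k \<in> {1, 2, 3, 4, 5, 6, 7}" using assms by auto
    show "bij_betw f (verts (pre_digraph.del_vert P7 7)) (verts (pre_digraph.del_vert P7 k))"
      unfolding bij_betw_def vs v6 unfolding atLeastAtMost_int_7
      using k by (elim insertE emptyE) (simp_all add: f_def, (auto simp: inj_on_def)?)
    fix i j
    assume "i \<in> verts (pre_digraph.del_vert P7 7)" "j \<in> verts (pre_digraph.del_vert P7 7)"
    then have ij: "i \<in> {1, 2, 3, 4, 5, 6}" "j \<in> {1, 2, 3, 4, 5, 6}" unfolding vs v6 by auto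
    have ne: "f i \<noteq> k" "f j \<noteq> k"
      using k ij by (auto simp: f_def)
    have r: "f i \<in> {1..7}" "f j \<in> {1..7}" using pos_mod_bound[of 7] pos_mod_sign[of 7]
      by (auto simp: f_def add1_zle_eq)
    have "(f j - f i) mod 7 = (j - i) mod 7"
      by (simp add: f_def mod_diff_eq)
    moreover have "i \<noteq> 7" "j \<noteq> 7" "i \<in> {1..7}" "j \<in> {1..7}" using ij by auto
    ultimately show "i \<rightarrow>\<^bsub>pre_digraph.del_vert P7 7\<^esub> j \<longleftrightarrow> f i \<rightarrow>\<^bsub>pre_digraph.del_vert P7 k\<^esub> f j"
      unfolding es using ne r by presburger
  qed
qed

end

theory Submission
  imports Defs "HOL-Library.Sublist"
begin

text \<open>
  Every block is a copy of the Hamming space of words of length \<open>n\<close> over \<open>\<int>/3\<close>, and \<open>rot\<close> adds \<open>1\<close> to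
  every letter. For \<open>i < j\<close> the edge between \<open>x\<close> in block \<open>i\<close> and \<open>y\<close> in block \<open>j\<close> points from \<open>x\<close> to
  \<open>y\<close>, except that it is reversed when \<open>y\<close> is within distance \<open>f(i, j)\<close> of \<open>rot x\<close>. All these
  thresholds are small multiples of \<open>n\<close>.

  By concentration of measure, any two sets of positive density contain a pair of nearby words; applied
  to a set and to its image under \<open>rot\<close> this gives edges in both directions, so there is no large
  pure pair.

  If \<open>f\<close> grows rapidly in the lexicographic order of \<open>(i, -j)\<close>, then the triangle inequality forces a
  reversed edge whenever a chain of three smaller reversed edges shows that \<open>y\<close> is near \<open>rot x\<close>. A
  cycle of reversed edges with net rotation \<open>t \<noteq> 0\<close> mod 3 cannot occur either, as a word has distance
  \<open>n\<close> from its rotation by \<open>t\<close>. These rules for three and four blocks exclude every ordering of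
  \<open>D\<^sub>5\<close> and of \<open>P\<^sub>7\<^sup>-\<close>.
\<close>

section \<open>Concentration in Hamming spaces\<close>

definition words :: "'a set \<Rightarrow> nat \<Rightarrow> 'a list set" where
  "words S n = {xs. set xs \<subseteq> S \<and> length xs = n}"

lemma finite_words: "finite S \<Longrightarrow> finite (words S n)"
  and card_words: "finite S \<Longrightarrow> card (words S n) = card S ^ n"
  by (simp_all add: words_def finite_lists_length_eq card_lists_length_eq)

text \<open>The comparison stops at the end of the shorter list, so the triangle inequality holds
  only for equal lengths.\<close>

fun hamming :: "'a list \<Rightarrow> 'a list \<Rightarrow> nat" where
  "hamming (x # xs) (y # ys) = of_bool (x \<noteq> y) + hamming xs ys"
| "hamming _ _ = 0"

lemma hamming_commute: "hamming xs ys = hamming ys xs"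
  by (induction xs ys rule: hamming.induct) auto

lemma hamming_triangle:
  assumes "length xs = length ys" "length ys = length zs"
  shows "hamming xs zs \<le> hamming xs ys + hamming ys zs"
  using assms by (induction xs ys zs rule: list_induct3) auto

lemma card_eq_sum_card_sections:
  assumes "finite S" "A \<subseteq> words S (Suc n)"
  shows "card A = (\<Sum>x\<in>S. card {xs. x # xs \<in> A})"
proof -
  have fin: "finite {xs. x # xs \<in> A}" for x
  proof (rule finite_subset)
    show "{xs. x # xs \<in> A} \<subseteq> words S n"
      using assms(2) by (fastforce simp: words_def)
  qed (rule finite_words[OF assms(1)])
  have "A = (\<lambda>(x, xs). x # xs) ` (SIGMA x:S. {xs. x # xs \<in> A})"
  proof
    show "A \<subseteq> (\<lambda>(x, xs). x # xs) ` (SIGMA x:S. {xs. x # xs \<in> A})"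
    proof
      fix w assume w: "w \<in> A"
      then have "length w = Suc n" "set w \<subseteq> S" using assms(2) by (auto simp: words_def)
      then obtain x xs where "w = x # xs" "x \<in> S" by (cases w) auto
      then show "w \<in> (\<lambda>(x, xs). x # xs) ` (SIGMA x:S. {xs. x # xs \<in> A})" using w by force
    qed
  qed auto
  then have "card A = card ((\<lambda>(x, xs). x # xs) ` (SIGMA x:S. {xs. x # xs \<in> A}))" by simp
  also have "\<dots> = card (SIGMA x:S. {xs. x # xs \<in> A})"
    by (rule card_image) (auto simp: inj_on_def)
  finally show ?thesis using assms(1) fin by simp
qed

lemma sum_mult_sum_le:
  fixes a b :: "'a \<Rightarrow> real" and s M \<alpha> :: real
  assumes s: "s \<ge> 1" and \<alpha>: "\<alpha> > 0" and M: "M \<ge> 0"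
    and a: "\<And>x. x \<in> S \<Longrightarrow> 0 \<le> a x" "\<And>x. x \<in> S \<Longrightarrow> a x \<le> \<alpha>"
    and ab: "\<And>x. x \<in> S \<Longrightarrow> a x * b x \<le> M"
    and b: "\<And>x. x \<in> S \<Longrightarrow> \<alpha> * b x \<le> s * M"
  shows "sum a S * sum b S \<le> (real (card S))\<^sup>2 * (1 + s)\<^sup>2 / (4 * s) * M"
proof -
  define r where "r x = a x / \<alpha>" for x
  define R where "R = sum r S"
  define q where "q = real (card S)"
  have point: "\<alpha> * b x \<le> M * (1 + s - s * r x)" if "x \<in> S" for x
  proof (cases "s * r x \<le> 1")
    case True
    then have "M * s \<le> M * (1 + s - s * r x)" using M by (intro mult_left_mono) auto
    then show ?thesis using b[OF that] by (simp add: mult.commute)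
  next
    case False
    then have r0: "r x > 0" using s by (smt (verit) mult_nonneg_nonpos)
    have r1: "r x \<le> 1" using a[OF that] \<alpha> by (simp add: r_def)
    have "(1 - r x) * (s * r x - 1) \<ge> 0" using r1 False by auto
    then have "1 \<le> (1 + s - s * r x) * r x" by (simp add: algebra_simps)
    then have "M * 1 \<le> M * ((1 + s - s * r x) * r x)" using M by (rule mult_left_mono)
    moreover have "\<alpha> * b x * r x \<le> M" using ab[OF that] \<alpha> by (simp add: r_def mult.commute)
    ultimately have "\<alpha> * b x * r x \<le> M * (1 + s - s * r x) * r x" by (simp add: mult.assoc)
    then show ?thesis using r0 by (rule mult_right_le_imp_le)
  qed
  have "\<alpha> * sum b S \<le> (\<Sum>x\<in>S. M * (1 + s - s * r x))"
    unfolding sum_distrib_left by (rule sum_mono) (rule point)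
  also have "\<dots> = M * (q * (1 + s) - s * R)"
    by (simp add: sum_distrib_left[symmetric] sum_subtractf R_def q_def)
  finally have 1: "\<alpha> * sum b S \<le> M * (q * (1 + s) - s * R)" .
  have R0: "R \<ge> 0" unfolding R_def r_def using a \<alpha> by (intro sum_nonneg) auto
  \<comment> \<open>The quadratic (q (1 + s) - s R) R peaks where this square vanishes.\<close>
  have "0 \<le> (q * (1 + s) - 2 * s * R)\<^sup>2" by simp
  then have "(q * (1 + s) - s * R) * R * (4 * s) \<le> q\<^sup>2 * (1 + s)\<^sup>2"
    by (simp add: power2_eq_square algebra_simps)
  then have 2: "(q * (1 + s) - s * R) * R \<le> q\<^sup>2 * (1 + s)\<^sup>2 / (4 * s)"
    using s by (simp add: pos_le_divide_eq)
  have "sum a S = \<alpha> * R" using \<alpha> by (simp add: R_def r_def sum_divide_distrib[symmetric])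
  then have "sum a S * sum b S = R * (\<alpha> * sum b S)" by simp
  also have "\<dots> \<le> R * (M * (q * (1 + s) - s * R))" using 1 R0 by (rule mult_left_mono)
  also have "\<dots> = M * ((q * (1 + s) - s * R) * R)" by simp
  also have "\<dots> \<le> M * (q\<^sup>2 * (1 + s)\<^sup>2 / (4 * s))" using 2 M by (rule mult_left_mono)
  finally show ?thesis by (simp add: q_def mult.commute)
qed

text \<open>
  Induction on \<open>n\<close>: pairing the section of \<open>B\<close> at \<open>x\<close> with the section of \<open>A\<close> at \<open>x\<close> keeps the
  distance \<open>k\<close>, while pairing it with the largest section of \<open>A\<close> loses at most one.
\<close>

lemma hamming_separated_card_le:
  fixes s :: real
  assumes S: "finite S" and s: "s \<ge> 1"
    and "A \<subseteq> words S n" "B \<subseteq> words S n" "\<And>a b. a \<in> A \<Longrightarrow> b \<in> B \<Longrightarrow> k \<le> hamming a b"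
  shows "real (card A) * real (card B) * s ^ k \<le> ((real (card S))\<^sup>2 * (1 + s)\<^sup>2 / (4 * s)) ^ n"
  using assms(3-)
proof (induction n arbitrary: A B k)
  case 0
  have cases: "A = {} \<or> A = {[]}" "B = {} \<or> B = {[]}" using 0(1,2) by (auto simp: words_def)
  show ?case
  proof (cases "A = {} \<or> B = {}")
    case False
    then have "A = {[]}" "B = {[]}" using cases by auto
    moreover from this have "k = 0" using 0(3)[of "[]" "[]"] by simp
    ultimately show ?thesis by simp
  qed auto
next
  case (Suc n)
  define C where "C = (real (card S))\<^sup>2 * (1 + s)\<^sup>2 / (4 * s)"
  define M where "M = C ^ n / s ^ k"
  define a where "a x = real (card {xs. x # xs \<in> A})" for x
  define b where "b x = real (card {xs. x # xs \<in> B})" for x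
  have C0: "C \<ge> 0" using s by (simp add: C_def)
  have sub: "{xs. x # xs \<in> A} \<subseteq> words S n" "{xs. x # xs \<in> B} \<subseteq> words S n" for x
    using Suc.prems(1,2) by (fastforce simp: words_def)+
  have cA: "real (card A) = sum a S" and cB: "real (card B) = sum b S"
    using card_eq_sum_card_sections[OF S Suc.prems(1)] card_eq_sum_card_sections[OF S Suc.prems(2)]
    by (simp_all add: a_def b_def)
  show ?case
  proof (cases "sum a S = 0")
    case True
    then show ?thesis using C0 unfolding cA C_def[symmetric] by simp
  next
    case False
    then have "S \<noteq> {}" by auto
    define \<alpha> where "\<alpha> = Max (a ` S)"
    obtain x0 where x0: "x0 \<in> S" "a x0 = \<alpha>"
      using Max_in[of "a ` S"] S \<open>S \<noteq> {}\<close> unfolding \<alpha>_def by fastforce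
    have le: "a x \<le> \<alpha>" if "x \<in> S" for x using S that by (simp add: \<alpha>_def)
    have "\<alpha> \<ge> 0" using x0 by (auto simp: a_def)
    moreover have "\<alpha> \<noteq> 0"
    proof
      assume "\<alpha> = 0"
      then have "\<forall>x\<in>S. a x = 0" using le by (force simp: a_def)
      then show False using False by simp
    qed
    ultimately have \<alpha>: "\<alpha> > 0" by simp
    have diag: "a x * b x \<le> M" for x
    proof -
      have "a x * b x * s ^ k \<le> C ^ n"
        unfolding a_def b_def C_def
        by (rule Suc.IH[OF sub]) (use Suc.prems(3) in force)
      then show ?thesis using s by (simp add: M_def pos_le_divide_eq)
    qed
    have cross: "\<alpha> * b x \<le> s * M" for x
    proof -
      have "a x0 * b x * s ^ (k - 1) \<le> C ^ n"
        unfolding a_def b_def C_def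
      proof (rule Suc.IH[OF sub])
        fix xs ys assume "xs \<in> {xs. x0 # xs \<in> A}" "ys \<in> {xs. x # xs \<in> B}"
        then have "k \<le> hamming (x0 # xs) (x # ys)" using Suc.prems(3) by blast
        then show "k - 1 \<le> hamming xs ys" by (cases "x0 = x") auto
      qed
      then have "s * (\<alpha> * b x * s ^ (k - 1)) \<le> s * C ^ n"
        using s x0 by (intro mult_left_mono) auto
      moreover have "\<alpha> * b x * s ^ k \<le> s * (\<alpha> * b x * s ^ (k - 1))"
      proof (cases k)
        \<comment> \<open>Truncated subtraction leaves the exponent at 0 here, so the extra factor
          comes from s \<ge> 1.\<close>
        case 0
        have "1 * (\<alpha> * b x) \<le> s * (\<alpha> * b x)"
          using s \<alpha> by (intro mult_right_mono) (auto simp: b_def)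
        then show ?thesis using 0 by simp
      qed simp
      ultimately have "\<alpha> * b x * s ^ k \<le> s * C ^ n" by linarith
      then show ?thesis using s by (simp add: M_def pos_le_divide_eq)
    qed
    have "sum a S * sum b S \<le> C * M"
      unfolding C_def
    proof (rule sum_mult_sum_le[OF s \<alpha>])
      show "M \<ge> 0" using C0 s by (simp add: M_def)
    qed (use le diag cross in \<open>auto simp: a_def\<close>)
    then show ?thesis
      using s unfolding cA cB C_def[symmetric] by (simp add: M_def pos_le_divide_eq)
  qed
qed

text \<open>For sets more than m apart, \<open>hamming_separated_card_le\<close> with k = m bounds
  \<epsilon>^2 by (c^L / s)^m, where c = (1 + s)^2 / (4 s). As c^L < s, this fails for large
  m.\<close>

lemma eventually_hamming_close:
  fixes \<epsilon> :: real and L :: nat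
  assumes S: "finite S" "S \<noteq> {}" and \<epsilon>: "\<epsilon> > 0" and L: "L > 0"
  shows "\<forall>\<^sub>F m in sequentially. \<forall>A B. A \<subseteq> words S (L * m) \<longrightarrow> B \<subseteq> words S (L * m) \<longrightarrow>
    \<epsilon> * real (card S ^ (L * m)) \<le> real (card A) \<longrightarrow> \<epsilon> * real (card S ^ (L * m)) \<le> real (card B) \<longrightarrow>
    (\<exists>a\<in>A. \<exists>b\<in>B. hamming a b \<le> m)"
proof -
  \<comment> \<open>For s = 1 + \<delta>, c is at most 1 + \<delta>^2 / 4, so c^L is at most about 1
    + L \<delta>^2 / 4; the choice \<delta> = 1 / L keeps this below s.\<close>
  define s :: real where "s = 1 + 1 / real L"
  define c where "c = (1 + s)\<^sup>2 / (4 * s)"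
  define q where "q = real (card S)"
  have s1: "s > 1" using L by (simp add: s_def)
  have q: "q > 0" using S by (simp add: q_def card_gt_0_iff)
  have c0: "c > 0" using s1 by (simp add: c_def)
  have c_le: "c \<le> 1 + 1 / (4 * (real L)\<^sup>2)"
  proof -
    have "c = 1 + (s - 1)\<^sup>2 / (4 * s)"
      using s1 by (simp add: c_def field_simps power2_eq_square)
    also have "\<dots> \<le> 1 + (s - 1)\<^sup>2 / 4"
      using s1 by (intro add_left_mono divide_left_mono) auto
    also have "(s - 1)\<^sup>2 / 4 = 1 / (4 * (real L)\<^sup>2)" by (simp add: s_def power_divide)
    finally show ?thesis .
  qed
  have "c ^ L \<le> exp (1 / (4 * (real L)\<^sup>2)) ^ L"
    using c0 c_le exp_ge_add_one_self[of "1 / (4 * (real L)\<^sup>2)"] by (intro power_mono) linarith+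
  also have "\<dots> = exp (1 / (4 * real L))"
    using L by (simp add: exp_of_nat_mult[symmetric] power2_eq_square)
  also have "\<dots> \<le> 1 + 1 / (4 * real L) + (1 / (4 * real L))\<^sup>2"
    using L by (intro exp_bound) auto
  also have "\<dots> < s"
  proof -
    have "(1 / (4 * real L))\<^sup>2 \<le> 1 / (4 * real L) * 1"
      unfolding power2_eq_square using L by (intro mult_left_mono) auto
    then show ?thesis using L by (simp add: s_def field_simps)
  qed
  finally have "c ^ L / s < 1" using s1 by simp
  moreover have "c ^ L / s \<ge> 0" using c0 s1 by simp
  ultimately have "(\<lambda>m. (c ^ L / s) ^ m) \<longlonglongrightarrow> 0" by (intro LIMSEQ_power_zero) auto
  then have "\<forall>\<^sub>F m in sequentially. (c ^ L / s) ^ m < \<epsilon>\<^sup>2"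
    using \<epsilon> by (intro order_tendstoD(2)) auto
  then show ?thesis
  proof (rule eventually_mono, intro allI impI)
    fix m and A B :: "'a list set"
    assume small: "(c ^ L / s) ^ m < \<epsilon>\<^sup>2" and sub: "A \<subseteq> words S (L * m)" "B \<subseteq> words S (L * m)"
      and A: "\<epsilon> * real (card S ^ (L * m)) \<le> real (card A)"
      and B: "\<epsilon> * real (card S ^ (L * m)) \<le> real (card B)"
    show "\<exists>a\<in>A. \<exists>b\<in>B. hamming a b \<le> m"
    proof (rule ccontr)
      assume far: "\<not> (\<exists>a\<in>A. \<exists>b\<in>B. hamming a b \<le> m)"
      have "(\<epsilon> * q ^ (L * m)) * (\<epsilon> * q ^ (L * m)) * s ^ m \<le> real (card A) * real (card B) * s ^ m"
        using A B \<epsilon> s1 q by (intro mult_right_mono mult_mono) (auto simp: q_def)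
      also have "\<dots> \<le> (q\<^sup>2 * (1 + s)\<^sup>2 / (4 * s)) ^ (L * m)"
        unfolding q_def using far s1 by (intro hamming_separated_card_le[OF S(1) _ sub]) force+
      also have "\<dots> = (q\<^sup>2 * c) ^ (L * m)" by (simp add: c_def)
      also have "\<dots> = q ^ (L * m) * q ^ (L * m) * c ^ (L * m)"
        by (simp add: power_mult_distrib power2_eq_square)
      finally have "(q ^ (L * m) * q ^ (L * m)) * (\<epsilon>\<^sup>2 * s ^ m) \<le> (q ^ (L * m) * q ^ (L * m)) * c ^ (L * m)"
        by (simp add: power2_eq_square mult_ac)
      then have "\<epsilon>\<^sup>2 * s ^ m \<le> c ^ (L * m)" using q by (simp add: mult_le_cancel_left_pos)
      also have "c ^ (L * m) = (c ^ L / s) ^ m * s ^ m"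
        using s1 by (simp add: power_mult power_divide)
      finally have "\<epsilon>\<^sup>2 \<le> (c ^ L / s) ^ m" using s1 by (simp add: mult_le_cancel_right)
      then show False using small by simp
    qed
  qed
qed

section \<open>Orderings of tournaments\<close>

text \<open>
  Vertices are listed in the order of their blocks, so that \<open>E v u\<close> for \<open>u\<close> before \<open>v\<close> says that the
  edge \<open>uv\<close> is reversed. The conditions are those enforced by the lemmas
  \<open>close_triangle\<close>, \<open>close_zigzag\<close>, \<open>close_shift\<close> and \<open>close_quadrangle\<close> below.
\<close>

fun admissible :: "('a \<Rightarrow> 'a \<Rightarrow> bool) \<Rightarrow> 'a list \<Rightarrow> bool" where
  "admissible E [p, q, r] \<longleftrightarrow> \<not> (E q p \<and> E r q \<and> E r p)"
| "admissible E [p, q, r, s] \<longleftrightarrow>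
    (E r p \<and> E s p \<and> E s q \<longrightarrow> E r q) \<and>
    (E q p \<and> E r p \<and> E s q \<longrightarrow> E s r) \<and>
    \<not> (E q p \<and> E r q \<and> E s r \<and> E s p)"
| "admissible E _ \<longleftrightarrow> True"

text \<open>An executable search that extends lists at the front. Only sublists starting with the
  new head are tested, as the others were tested before.\<close>

primrec admissible_orderings :: "('a \<Rightarrow> 'a \<Rightarrow> bool) \<Rightarrow> 'a list \<Rightarrow> nat \<Rightarrow> 'a list list" where
  "admissible_orderings E vs 0 = [[]]"
| "admissible_orderings E vs (Suc n) =
    [p # xs. xs \<leftarrow> admissible_orderings E vs n, p \<leftarrow> vs,
      p \<notin> set xs \<and> list_all (\<lambda>ys. admissible E (p # ys)) (subseqs xs)]"

text \<open>Completeness of the search: sublists of a tail are sublists of the whole list, so no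
  ordering with only admissible sublists is pruned. An empty result therefore excludes every
  ordering.\<close>

lemma in_admissible_orderings:
  assumes "distinct xs" "set xs \<subseteq> set vs" "\<And>ys. subseq ys xs \<Longrightarrow> admissible E ys"
  shows "xs \<in> set (admissible_orderings E vs (length xs))"
  using assms
proof (induction xs)
  case (Cons x xs)
  have "admissible E ys" if "subseq ys xs" for ys using Cons.prems(3) that by blast
  then have "xs \<in> set (admissible_orderings E vs (length xs))" using Cons by auto
  moreover have "admissible E (x # ys)" if "subseq ys xs" for ys
    using Cons.prems(3) that by simp
  ultimately show ?case using Cons.prems by (auto simp: list_all_iff)
qed simp

lemma sorted_wrt_subseq: "subseq ys xs \<Longrightarrow> sorted_wrt R xs \<Longrightarrow> sorted_wrt R ys"
  by (induction rule: list_emb.induct) (auto dest: list_emb_set)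

text \<open>Each of the 120 orderings violates a condition on some three or four vertices, which is
  checked by evaluating the search.\<close>

lemma no_admissible_orderings_D5:
  "admissible_orderings (\<lambda>i j. (j - i) mod 5 \<in> {1, 2}) [1, 2, 3, 4, 5 :: int]
    (length [1, 2, 3, 4, 5 :: int]) = []"
  by code_simp

text \<open>On 1, ..., 6 the differences modulo 7 describe \<open>P7\<close> without the vertex 7;
  the search rules out all 720 orderings.\<close>

lemma no_admissible_orderings_P7_minus:
  "admissible_orderings (\<lambda>i j. (j - i) mod 7 \<in> {1, 2, 4}) [1, 2, 3, 4, 5, 6 :: int]
    (length [1, 2, 3, 4, 5, 6 :: int]) = []"
  by code_simp

section \<open>Rainbow copies as injective vertex maps\<close>

lemma has_rainbow_copyE:
  assumes "has_rainbow_copy H G I B" and H: "digraph H"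
  obtains \<phi> where "inj_on \<phi> (verts H)" "\<phi> ` verts H \<subseteq> (\<Union>i\<in>I. B i)"
    "\<And>i u v. i \<in> I \<Longrightarrow> u \<in> verts H \<Longrightarrow> v \<in> verts H \<Longrightarrow> \<phi> u \<in> B i \<Longrightarrow> \<phi> v \<in> B i \<Longrightarrow> u = v"
    "\<And>u v. u \<in> verts H \<Longrightarrow> v \<in> verts H \<Longrightarrow> u \<rightarrow>\<^bsub>H\<^esub> v \<longleftrightarrow> \<phi> u \<rightarrow>\<^bsub>G\<^esub> \<phi> v"
proof -
  obtain K where ind: "induced_subgraph K G" and "digraph_iso H K" and rb: "rainbow I B K"
    using assms(1) by (auto simp: has_rainbow_copy_def is_copy_def)
  then obtain h where h: "pre_digraph.digraph_isomorphism H h" and K: "K = app_iso h H"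
    by (auto simp: digraph_iso_def)
  interpret H: digraph H by fact
  define \<phi> where "\<phi> = iso_verts h"
  have inj: "inj_on \<phi> (verts H)"
    unfolding \<phi>_def by (rule pre_digraph.digraph_isomorphism_inj_on_verts[OF h])
  have vK: "verts K = \<phi> ` verts H" by (simp add: K \<phi>_def)
  have ends: "tail K (iso_arcs h e) = \<phi> (tail H e)" "head K (iso_arcs h e) = \<phi> (head H e)"
    if "e \<in> arcs H" for e
    using pre_digraph.iso_verts_tail[OF h that] pre_digraph.iso_verts_head[OF h that]
    by (simp_all add: K \<phi>_def)
  have th: "tail G = tail K" "head G = head K"
    and arcs: "arcs K = {e \<in> arcs G. tail G e \<in> verts K \<and> head G e \<in> verts K}"
    using ind by (auto simp: induced_subgraph_def subgraph_def compatible_def)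
  have adj: "u \<rightarrow>\<^bsub>H\<^esub> v \<longleftrightarrow> \<phi> u \<rightarrow>\<^bsub>G\<^esub> \<phi> v" if uv: "u \<in> verts H" "v \<in> verts H" for u v
  proof
    assume "u \<rightarrow>\<^bsub>H\<^esub> v"
    then obtain e where e: "e \<in> arcs H" "tail H e = u" "head H e = v" by auto
    then have "iso_arcs h e \<in> arcs G" using arcs by (auto simp: K)
    moreover have "tail G (iso_arcs h e) = \<phi> u" "head G (iso_arcs h e) = \<phi> v"
      using e ends th by auto
    ultimately show "\<phi> u \<rightarrow>\<^bsub>G\<^esub> \<phi> v" by (force simp: arcs_ends_conv)
  next
    assume "\<phi> u \<rightarrow>\<^bsub>G\<^esub> \<phi> v"
    then obtain e where e: "e \<in> arcs G" "tail G e = \<phi> u" "head G e = \<phi> v" by auto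
    \<comment> \<open>An induced subgraph contains every arc of \<open>G\<close> between its
      vertices.\<close>
    then have "e \<in> arcs K" using arcs uv vK by auto
    then obtain e' where e': "e' \<in> arcs H" "e = iso_arcs h e'" by (auto simp: K)
    then have "\<phi> (tail H e') = \<phi> u" "\<phi> (head H e') = \<phi> v" using e ends th by auto
    then have "tail H e' = u" "head H e' = v"
      using inj uv e' by (auto dest: inj_onD)
    then show "u \<rightarrow>\<^bsub>H\<^esub> v" using e' by (force simp: arcs_ends_conv)
  qed
  show thesis
  proof (rule that[OF inj _ _ adj])
    show "\<phi> ` verts H \<subseteq> (\<Union>i\<in>I. B i)" using rb by (simp add: rainbow_def vK)
    fix i u v assume "i \<in> I" "u \<in> verts H" "v \<in> verts H" "\<phi> u \<in> B i" "\<phi> v \<in> B i"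
    then have "\<phi> u = \<phi> v" using rb unfolding rainbow_def vK by blast
    then show "u = v" using inj \<open>u \<in> verts H\<close> \<open>v \<in> verts H\<close> by (auto dest: inj_onD)
  qed
qed

section \<open>The tournament\<close>

definition rot :: "nat list \<Rightarrow> nat list" where
  "rot = map (\<lambda>a. (a + 1) mod 3)"

lemma rot_in_words: "x \<in> words {..<3} n \<Longrightarrow> rot x \<in> words {..<3} n"
  by (auto simp: words_def rot_def)

lemma hamming_rot_rot:
  assumes "x \<in> words {..<3} n" "y \<in> words {..<3} n"
  shows "hamming (rot x) (rot y) = hamming x y"
proof -
  have "length x = length y" "set x \<subseteq> {..<3}" "set y \<subseteq> {..<3}"
    using assms by (auto simp: words_def)
  then show ?thesis
  proof (induction x y rule: list_induct2)
    case (Cons a x b y)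
    then have "a \<in> {0, 1, 2}" "b \<in> {0, 1, 2}" by auto
    then have "((a + 1) mod 3 = (b + 1) mod 3) = (a = b)" by auto
    then show ?case using Cons by (simp add: rot_def)
  qed (simp add: rot_def)
qed

text \<open>Adding 1 or 2 modulo 3 fixes no letter, so these rotations move every word as far as
  possible. Cycles of reversed edges are excluded by contradicting this distance.\<close>

lemma hamming_rot_self:
  assumes "x \<in> words {..<3} n"
  shows "hamming (rot x) x = n" "hamming (rot (rot x)) x = n" "rot (rot (rot x)) = x"
proof -
  have x: "set x \<subseteq> {..<3}" and n: "length x = n" using assms by (auto simp: words_def)
  have "(a + 1) mod 3 \<noteq> a \<and> ((a + 1) mod 3 + 1) mod 3 \<noteq> a \<and> (((a + 1) mod 3 + 1) mod 3 + 1) mod 3 = a"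
    if "a < 3" for a :: nat
  proof -
    from that have "a \<in> {0, 1, 2}" by auto
    then show ?thesis by auto
  qed
  then show "hamming (rot x) x = n" "hamming (rot (rot x)) x = n" "rot (rot (rot x)) = x"
    unfolding n[symmetric] using x by (induction x) (auto simp: rot_def)
qed

lemma inj_on_rot_words: "inj_on rot (words {..<3} n)"
  by (rule inj_on_inverseI[where g = "\<lambda>x. rot (rot x)"]) (rule hamming_rot_self(3))

text \<open>\<open>K\<close> is the number of blocks and \<open>m\<close> the radius in the
  concentration bound. Thresholds between blocks are at most \<open>3 ^ K\<^sup>2 * m\<close>, so
  the factor 5 keeps a sum of four of them below \<open>n\<close>.\<close>

locale rotation_tournament =
  fixes K m n :: nat
  assumes m_pos: "m > 0" and n_eq: "n = 5 * 3 ^ K\<^sup>2 * m"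
begin

text \<open>For i < j < K the exponent ranks pairs by increasing i, then by decreasing j, because 1
  \<le> K - j \<le> K. With base 3 a threshold absorbs the sum of any three of lower rank.\<close>

definition thr :: "nat \<Rightarrow> nat \<Rightarrow> nat" where
  "thr i j = m * 3 ^ (i * K + (K - j))"

definition close :: "nat \<Rightarrow> nat list \<Rightarrow> nat list \<Rightarrow> bool" where
  "close d x y \<longleftrightarrow> hamming (rot x) y \<le> d"

abbreviation W :: "nat list set" where
  "W \<equiv> words {..<3} n"

text \<open>A rainbow copy has no edge inside a block. There closeness is used to exclude pure pairs
  within one block, and the encoding as a natural number decides the remaining edges.\<close>

fun beats :: "nat \<times> nat list \<Rightarrow> nat \<times> nat list \<Rightarrow> bool" where
  "beats (i, x) (j, y) \<longleftrightarrow>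
    (if i < j then \<not> close (thr i j) x y
     else if j < i then close (thr j i) y x
     else close m x y \<or> \<not> close m y x \<and> to_nat x < to_nat y)"

section \<open>Growth of the thresholds\<close>

lemma thr_le: "i < j \<Longrightarrow> j < K \<Longrightarrow> thr i j \<le> 3 ^ K\<^sup>2 * m"
proof -
  assume "i < j" "j < K"
  then have "(i + 1) * K \<le> K * K" by (intro mult_right_mono) auto
  then have "i * K + (K - j) \<le> K\<^sup>2" by (simp add: power2_eq_square)
  then have "(3::nat) ^ (i * K + (K - j)) \<le> 3 ^ K\<^sup>2" by (intro power_increasing) auto
  then show ?thesis by (simp add: thr_def)
qed

lemma m_le: "m \<le> 3 ^ K\<^sup>2 * m" by simp

lemma m_le_thr: "m \<le> thr i j"
  by (simp add: thr_def)

lemma three_thr_le: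
  assumes "i * K + (K - j) < i' * K + (K - j')"
  shows "3 * thr i j \<le> thr i' j'"
proof -
  have "(3::nat) ^ Suc (i * K + (K - j)) \<le> 3 ^ (i' * K + (K - j'))"
    using assms by (intro power_increasing) auto
  then show ?thesis by (simp add: thr_def)
qed

lemma three_thr_le_less_min:
  assumes "i < i'" "j' < K"
  shows "3 * thr i j \<le> thr i' j'"
proof (rule three_thr_le)
  have "(i + 1) * K \<le> i' * K" using assms by (intro mult_right_mono) auto
  then show "i * K + (K - j) < i' * K + (K - j')" using assms by simp
qed

lemma three_thr_le_less_max:
  assumes "j' < j" "j < K"
  shows "3 * thr i j \<le> thr i j'"
  using assms by (intro three_thr_le) auto

section \<open>Chains of nearly rotated words\<close>

lemma hamming_triangle_W:
  "x \<in> W \<Longrightarrow> y \<in> W \<Longrightarrow> z \<in> W \<Longrightarrow> hamming x z \<le> hamming x y + hamming y z"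
  by (rule hamming_triangle) (auto simp: words_def)

lemma hamming_rotD: "x \<in> W \<Longrightarrow> y \<in> W \<Longrightarrow> hamming x y \<le> d \<Longrightarrow> hamming (rot x) (rot y) \<le> d"
  by (simp add: hamming_rot_rot)

text \<open>As \<open>rot\<close> is an isometry, the first relation can be rotated once and joined
  to the second.\<close>

lemma close_trans:
  assumes "x \<in> W" "y \<in> W" "z \<in> W" "close d x y" "close e y z"
  shows "hamming (rot (rot x)) z \<le> d + e"
proof -
  have "hamming (rot (rot x)) z \<le> hamming (rot (rot x)) (rot y) + hamming (rot y) z"
    using assms by (intro hamming_triangle_W rot_in_words)
  moreover have "hamming (rot (rot x)) (rot y) \<le> d"
    using assms by (intro hamming_rotD rot_in_words) (simp_all add: close_def)
  ultimately show ?thesis using assms(5) by (simp add: close_def)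
qed

text \<open>By way of y the word z is near the double rotation of x, and directly it is near
  \<open>rot x\<close>; these two are n apart.\<close>

lemma close_triangle:
  assumes "x \<in> W" "y \<in> W" "z \<in> W" "close d1 x y" "close d2 y z" "close d3 x z"
  shows "n \<le> d1 + d2 + d3"
proof -
  have "n = hamming (rot (rot x)) (rot x)"
    using hamming_rot_self(1)[OF rot_in_words[OF assms(1)]] by simp
  also have "\<dots> \<le> hamming (rot (rot x)) z + hamming z (rot x)"
    using assms by (intro hamming_triangle_W rot_in_words)
  finally show ?thesis
    using close_trans[OF assms(1-5)] assms(6) by (simp add: close_def hamming_commute)
qed

text \<open>Along y and z the word w is near x rotated three times, which is x itself, while
  directly it is near \<open>rot x\<close>.\<close>

lemma close_quadrangle:
  assumes "x \<in> W" "y \<in> W" "z \<in> W" "w \<in> W"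
    and "close d1 x y" "close d2 y z" "close d3 z w" "close d4 x w"
  shows "n \<le> d1 + d2 + d3 + d4"
proof -
  have "hamming x (rot z) \<le> d1 + d2"
    using hamming_rotD[OF _ assms(3) close_trans[OF assms(1-3,5,6)]] assms(1)
    by (simp add: hamming_rot_self(3) rot_in_words)
  moreover have "hamming x w \<le> hamming x (rot z) + hamming (rot z) w"
    and "hamming x (rot x) \<le> hamming x w + hamming w (rot x)"
    using assms by (auto intro!: hamming_triangle_W rot_in_words)
  moreover have "hamming x (rot x) = n"
    using hamming_rot_self(1)[OF assms(1)] by (simp add: hamming_commute[of x])
  ultimately show ?thesis using assms(7,8) by (simp add: close_def hamming_commute)
qed

text \<open>The chain runs from \<open>rot q\<close> to s, then \<open>rot p\<close>, then
  r.\<close>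

lemma close_zigzag:
  assumes "p \<in> W" "q \<in> W" "r \<in> W" "s \<in> W" "close d1 p r" "close d2 p s" "close d3 q s"
  shows "close (d1 + d2 + d3) q r"
proof -
  have "hamming (rot q) r \<le> hamming (rot q) s + hamming s r"
    and "hamming s r \<le> hamming s (rot p) + hamming (rot p) r"
    using assms by (auto intro!: hamming_triangle_W rot_in_words)
  then show ?thesis using assms(5-) by (simp add: close_def hamming_commute)
qed

text \<open>Both q and r are near \<open>rot p\<close>, hence near each other; so
  \<open>rot r\<close> is near \<open>rot q\<close>, which is near s.\<close>

lemma close_shift:
  assumes "p \<in> W" "q \<in> W" "r \<in> W" "s \<in> W" "close d1 p q" "close d2 p r" "close d3 q s"
  shows "close (d1 + d2 + d3) r s"
proof -
  have "hamming (rot r) s \<le> hamming (rot r) (rot q) + hamming (rot q) s"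
    and "hamming r q \<le> hamming r (rot p) + hamming (rot p) q"
    using assms by (auto intro!: hamming_triangle_W rot_in_words)
  moreover have "hamming (rot r) (rot q) = hamming r q"
    using assms by (simp add: hamming_rot_rot)
  ultimately show ?thesis using assms(5-) by (simp add: close_def hamming_commute)
qed

lemma close_mono: "close d x y \<Longrightarrow> d \<le> e \<Longrightarrow> close e x y"
  by (simp add: close_def)

lemma four_thr_less: "4 * (3 ^ K\<^sup>2 * m) < n"
  using m_pos by (simp add: n_eq)

definition V :: "(nat \<times> nat list) set" where
  "V = {..<K} \<times> W"

text \<open>Reversed edges between blocks are exactly the close pairs. Forbidden cycles would bound
  \<open>n\<close> by at most four thresholds, and forced reversals come from a chain of three
  smaller thresholds.\<close>

lemma admissible_if_beats:
  assumes sorted: "sorted_wrt (\<lambda>u v. fst (g u) < fst (g v)) us"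
    and V: "\<And>u. u \<in> set us \<Longrightarrow> g u \<in> V"
    and E: "\<And>u v. u \<in> set us \<Longrightarrow> v \<in> set us \<Longrightarrow> E u v \<longleftrightarrow> beats (g u) (g v)"
  shows "admissible E us"
proof -
  have flip: "E v u \<longleftrightarrow> close (thr (fst (g u)) (fst (g v))) (snd (g u)) (snd (g v))"
    if "u \<in> set us" "v \<in> set us" "fst (g u) < fst (g v)" for u v
    using E[OF that(2,1)] that(3) by (cases "g u"; cases "g v") auto
  have W: "snd (g u) \<in> W" "fst (g u) < K" if "u \<in> set us" for u
    using V[OF that] by (auto simp: V_def)
  consider p q r where "us = [p, q, r]" | p q r s where "us = [p, q, r, s]"
    | "admissible E us"
    by (cases "(E, us)" rule: admissible.cases) auto
  then show ?thesis
  proof cases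
    case (1 p q r)
    have "\<not> (E q p \<and> E r q \<and> E r p)"
    proof
      assume "E q p \<and> E r q \<and> E r p"
      then have "n \<le> thr (fst (g p)) (fst (g q)) + thr (fst (g q)) (fst (g r)) + thr (fst (g p)) (fst (g r))"
        using W sorted flip 1 by (intro close_triangle[of "snd (g p)" "snd (g q)" "snd (g r)"]) auto
      moreover have "thr (fst (g p)) (fst (g q)) \<le> 3 ^ K\<^sup>2 * m" "thr (fst (g q)) (fst (g r)) \<le> 3 ^ K\<^sup>2 * m"
        "thr (fst (g p)) (fst (g r)) \<le> 3 ^ K\<^sup>2 * m"
        using W sorted 1 by (auto intro!: thr_le)
      ultimately show False using four_thr_less by linarith
    qed
    then show ?thesis using 1 by simp
  next
    case (2 p q r s)
    define i j k l where "i = fst (g p)" and "j = fst (g q)" and "k = fst (g r)" and "l = fst (g s)"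
    define x y z w where "x = snd (g p)" and "y = snd (g q)" and "z = snd (g r)" and "w = snd (g s)"
    note ijkl = i_def j_def k_def l_def and xyzw = x_def y_def z_def w_def
    have lt: "i < j" "i < k" "i < l" "j < k" "j < l" "k < l" "l < K" "k < K" "j < K"
      and inW: "x \<in> W" "y \<in> W" "z \<in> W" "w \<in> W"
      using W sorted 2 by (auto simp: ijkl xyzw)
    have E_close: "E q p = close (thr i j) x y" "E r p = close (thr i k) x z"
      "E s p = close (thr i l) x w" "E r q = close (thr j k) y z"
      "E s q = close (thr j l) y w" "E s r = close (thr k l) z w"
      using lt unfolding ijkl xyzw by (simp_all add: flip 2)
    have "E r q" if "E r p" "E s p" "E s q"
    proof -
      have "close (thr i k + thr i l + thr j l) y z"
        using that E_close by (intro close_zigzag[OF inW]) auto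
      \<comment> \<open>The pair (j, k) outranks (i, k) and (i, l) by its smaller index, and (j, l)
        by its larger one.\<close>
      moreover have "3 * thr i k \<le> thr j k" "3 * thr i l \<le> thr j k" "3 * thr j l \<le> thr j k"
        using lt by (auto intro: three_thr_le_less_min three_thr_le_less_max)
      ultimately show ?thesis unfolding E_close by (elim close_mono) linarith
    qed
    moreover have "E s r" if "E q p" "E r p" "E s q"
    proof -
      have "close (thr i j + thr i k + thr j l) z w"
        using that E_close by (intro close_shift[OF inW]) auto
      \<comment> \<open>The smaller index k exceeds both i and j.\<close>
      moreover have "3 * thr i j \<le> thr k l" "3 * thr i k \<le> thr k l" "3 * thr j l \<le> thr k l"
        using lt by (auto intro: three_thr_le_less_min)
      ultimately show ?thesis unfolding E_close by (elim close_mono) linarith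
    qed
    moreover have "\<not> (E q p \<and> E r q \<and> E s r \<and> E s p)"
    proof
      assume "E q p \<and> E r q \<and> E s r \<and> E s p"
      then have "n \<le> thr i j + thr j k + thr k l + thr i l"
        using E_close by (intro close_quadrangle[OF inW]) auto
      moreover have "thr i j \<le> 3 ^ K\<^sup>2 * m" "thr j k \<le> 3 ^ K\<^sup>2 * m" "thr k l \<le> 3 ^ K\<^sup>2 * m"
        "thr i l \<le> 3 ^ K\<^sup>2 * m"
        using lt by (auto intro!: thr_le)
      ultimately show False using four_thr_less by linarith
    qed
    ultimately show ?thesis using 2 by simp
  qed
qed

section \<open>The tournament and its blockade\<close>

definition T :: "nat pair_pre_digraph" where
  "T = \<lparr> pverts = to_nat ` V, parcs = {(to_nat u, to_nat v) | u v. u \<in> V \<and> v \<in> V \<and> beats u v} \<rparr>"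

definition block :: "int \<Rightarrow> nat set" where
  "block i = to_nat ` ({nat i} \<times> W)"

definition I :: "int set" where
  "I = int ` {..<K}"

lemma verts_T: "verts T = to_nat ` V" "pverts T = to_nat ` V"
  by (simp_all add: T_def)

lemma adj_T: "u \<in> V \<Longrightarrow> v \<in> V \<Longrightarrow> to_nat u \<rightarrow>\<^bsub>T\<^esub> to_nat v \<longleftrightarrow> beats u v"
  by (cases u; cases v) (auto simp: T_def simp del: beats.simps)

lemma finite_V: "finite V"
  by (simp add: V_def finite_words)

lemma card_verts_T: "card (verts T) = K * 3 ^ n"
  unfolding verts_T by (simp add: card_image V_def card_words card_cartesian_product)

text \<open>Otherwise x would be within 2 m of its double rotation. This makes the rule inside a
  block antisymmetric.\<close>

lemma not_close_close:
  assumes "x \<in> W" "y \<in> W" "close m x y"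
  shows "\<not> close m y x"
proof
  assume "close m y x"
  then have "n \<le> m + m"
    using close_trans[OF assms(1,2,1,3)] assms(1) by (simp add: hamming_rot_self(2))
  then show False using four_thr_less m_le by linarith
qed

lemma beats_irrefl: "u \<in> V \<Longrightarrow> \<not> beats u u"
  using not_close_close by (cases u) (auto simp: V_def)

lemma beats_total:
  assumes "u \<in> V" "v \<in> V" "u \<noteq> v"
  shows "beats u v \<noteq> beats v u"
proof (cases u; cases v)
  fix i x j y assume uv: "u = (i, x)" "v = (j, y)"
  then have W: "x \<in> W" "y \<in> W" using assms by (auto simp: V_def)
  show ?thesis
  proof (cases "i = j")
    case True
    then have "x \<noteq> y" using assms(3) uv by simp
    then have "to_nat x \<noteq> to_nat y" by simp
    then have "to_nat x < to_nat y \<longleftrightarrow> \<not> to_nat y < to_nat x" by (metis not_less_iff_gr_or_eq)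
    then show ?thesis using True uv W not_close_close[of x y] by auto
  qed (use uv in auto)
qed

lemma tournament_T: "tournament T"
proof -
  have "digraph T"
    unfolding T_def
  proof (rule digraph_with_projI)
    fix a b assume "(a, b) \<in> {(to_nat u, to_nat v) | u v. u \<in> V \<and> v \<in> V \<and> beats u v}"
    then obtain u v where uv: "a = to_nat u" "b = to_nat v" "u \<in> V" "v \<in> V" "beats u v" by blast
    then have "u \<noteq> v" using beats_irrefl by blast
    then show "a \<in> to_nat ` V \<and> b \<in> to_nat ` V \<and> a \<noteq> b" using uv(1-4) by simp
  qed (simp add: finite_V)
  moreover have "(a \<rightarrow>\<^bsub>T\<^esub> b) \<noteq> (b \<rightarrow>\<^bsub>T\<^esub> a)" if ab: "a \<in> verts T" "b \<in> verts T" "a \<noteq> b" for a b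
  proof -
    obtain u v where uv: "a = to_nat u" "b = to_nat v" "u \<in> V" "v \<in> V"
      using ab unfolding verts_T by blast
    then have "u \<noteq> v" using ab(3) by blast
    then show ?thesis using beats_total uv(3,4) unfolding uv(1,2) adj_T[OF uv(3,4)] adj_T[OF uv(4,3)] by blast
  qed
  ultimately show ?thesis unfolding tournament_def by blast
qed

lemma card_block: "card (block i) = 3 ^ n"
  unfolding block_def by (subst card_image) (simp_all add: card_words card_cartesian_product)

lemma blockade_T: "blockade (verts T) I block"
proof -
  have "disjoint_family_on block I"
    by (auto simp: disjoint_family_on_def block_def I_def)
  moreover have "block i \<noteq> {}" for i
    using card_block[of i] by (metis card.empty power_not_zero zero_neq_numeral)
  moreover have "block i \<subseteq> verts T" if "i \<in> I" for i
    using that by (auto simp: block_def verts_T V_def I_def)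
  ultimately show ?thesis unfolding blockade_def by (simp add: I_def)
qed

lemma blockade_length_T: "blockade_length I = K"
  by (simp add: blockade_length_def I_def card_image)

lemma blockade_width_T: "K > 0 \<Longrightarrow> blockade_width I block = 3 ^ n"
  by (auto simp: blockade_width_def card_block I_def image_image image_constant_conv)

text \<open>Sorting the vertices of a rainbow copy by their blocks would give an ordering with only
  admissible sublists, which the search would have found.\<close>

lemma not_has_rainbow_copy_T:
  assumes H: "digraph H" and vs: "distinct vs" "set vs = verts H"
    and E: "\<And>u v. u \<in> verts H \<Longrightarrow> v \<in> verts H \<Longrightarrow> u \<rightarrow>\<^bsub>H\<^esub> v \<longleftrightarrow> E u v"
    and none: "admissible_orderings E vs (length vs) = []"
  shows "\<not> has_rainbow_copy H T I block"
proof
  assume "has_rainbow_copy H T I block"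
  then obtain \<phi> where inj: "inj_on \<phi> (verts H)" and im: "\<phi> ` verts H \<subseteq> (\<Union>i\<in>I. block i)"
    and rb: "\<And>i u v. i \<in> I \<Longrightarrow> u \<in> verts H \<Longrightarrow> v \<in> verts H \<Longrightarrow> \<phi> u \<in> block i \<Longrightarrow> \<phi> v \<in> block i \<Longrightarrow> u = v"
    and adj: "\<And>u v. u \<in> verts H \<Longrightarrow> v \<in> verts H \<Longrightarrow> u \<rightarrow>\<^bsub>H\<^esub> v \<longleftrightarrow> \<phi> u \<rightarrow>\<^bsub>T\<^esub> \<phi> v"
    by (rule has_rainbow_copyE[OF _ H]) blast
  define g where "g u = (from_nat (\<phi> u) :: nat \<times> nat list)" for u
  have g: "g u \<in> V" "\<phi> u = to_nat (g u)" if "u \<in> verts H" for u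
    using im that by (fastforce simp: g_def block_def I_def V_def)+
  define f where "f = fst \<circ> g"
  have "inj_on f (verts H)"
  proof (rule inj_onI)
    fix u v assume uv: "u \<in> verts H" "v \<in> verts H" "f u = f v"
    have "\<phi> u \<in> block (int (f u))" "\<phi> v \<in> block (int (f u))" "int (f u) \<in> I"
      using g[OF uv(1)] g[OF uv(2)] uv(3) by (auto simp: f_def block_def I_def V_def mem_Times_iff)
    then show "u = v" using rb uv by blast
  qed
  define xs where "xs = sort_key f vs"
  have xs: "set xs = verts H" "distinct xs" "length xs = length vs"
    using vs by (simp_all add: xs_def)
  \<comment> \<open>The order is strict because distinct vertices of a rainbow copy lie in distinct
    blocks.\<close>
  have "sorted_wrt (<) (map f xs)"
    using xs \<open>inj_on f (verts H)\<close> by (simp add: strict_sorted_iff distinct_map) (simp add: xs_def)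
  then have sorted: "sorted_wrt (\<lambda>u v. fst (g u) < fst (g v)) xs"
    by (simp add: sorted_wrt_map f_def)
  have "xs \<in> set (admissible_orderings E vs (length xs))"
  proof (rule in_admissible_orderings)
    fix ys assume ys: "subseq ys xs"
    then have sub: "set ys \<subseteq> verts H" using xs by (auto dest: list_emb_set)
    show "admissible E ys"
    proof (rule admissible_if_beats)
      show "sorted_wrt (\<lambda>u v. fst (g u) < fst (g v)) ys" by (rule sorted_wrt_subseq[OF ys sorted])
      show "g u \<in> V" if "u \<in> set ys" for u using g sub that by blast
      fix u v assume "u \<in> set ys" "v \<in> set ys"
      then have "u \<in> verts H" "v \<in> verts H" using sub by auto
      then show "E u v \<longleftrightarrow> beats (g u) (g v)" using E adj g adj_T by metis
    qed
  qed (use xs vs in auto)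
  then show False using none xs by simp
qed

section \<open>Absence of large pure pairs\<close>

text \<open>Pigeonhole over the \<open>K\<close> blocks, at the cost of a factor \<open>K\<close> in
  the density.\<close>

lemma large_section:
  fixes c :: real
  assumes X: "X \<subseteq> verts T" and c: "c * 3 ^ n \<le> real (card X)" and K: "K > 0"
  obtains i where "i < K" "c / real K * 3 ^ n \<le> real (card {x \<in> W. to_nat (i, x) \<in> X})"
proof -
  define S where "S i = {x \<in> W. to_nat (i, x) \<in> X}" for i :: nat
  have fin: "finite (S i)" for i by (simp add: S_def finite_words)
  have "X \<subseteq> (\<Union>i<K. (\<lambda>x. to_nat (i, x)) ` S i)"
    using X by (fastforce simp: verts_T V_def S_def)
  then have "card X \<le> card (\<Union>i<K. (\<lambda>x. to_nat (i, x)) ` S i)"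
    using fin by (intro card_mono) auto
  also have "\<dots> \<le> (\<Sum>i<K. card ((\<lambda>x. to_nat (i, x)) ` S i))" by (rule card_UN_le) simp
  also have "\<dots> \<le> (\<Sum>i<K. card (S i))" using fin by (intro sum_mono card_image_le)
  finally have le: "real (card X) \<le> (\<Sum>i<K. real (card (S i)))" by (simp flip: of_nat_sum)
  have "\<exists>i<K. c / real K * 3 ^ n \<le> real (card (S i))"
  proof (rule ccontr)
    assume "\<not> ?thesis"
    then have "(\<Sum>i<K. real (card (S i))) < (\<Sum>i<K. c / real K * 3 ^ n)"
      using K by (intro sum_strict_mono) auto
    also have "\<dots> = c * 3 ^ n" using K by simp
    finally show False using le c by simp
  qed
  then show thesis using that unfolding S_def by blast
qed

text \<open>Dense sections of X and Y in single blocks contain a and b to which concentration gives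
  an edge from b to a. The rotation applied beforehand depends on the order of the two
  blocks.\<close>

lemma no_large_pure_pair:
  fixes c :: real
  assumes K: "K > 0"
    and hamming_close: "\<And>A B. A \<subseteq> W \<Longrightarrow> B \<subseteq> W \<Longrightarrow> c / real K * 3 ^ n \<le> real (card A) \<Longrightarrow>
      c / real K * 3 ^ n \<le> real (card B) \<Longrightarrow> \<exists>a\<in>A. \<exists>b\<in>B. hamming a b \<le> m"
  shows "\<not> (\<exists>X Y. pure_pair T X Y \<and> c * real (blockade_width I block) \<le> real (pair_order X Y))"
proof
  assume "\<exists>X Y. pure_pair T X Y \<and> c * real (blockade_width I block) \<le> real (pair_order X Y)"
  then obtain X Y where XY: "pure_pair T X Y" and X: "c * 3 ^ n \<le> real (card X)" and Y: "c * 3 ^ n \<le> real (card Y)"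
    using blockade_width_T[OF K] by (auto simp: pair_order_def)
  have "X \<subseteq> verts T" "Y \<subseteq> verts T" using XY by (auto simp: pure_pair_def)
  obtain i where i: "i < K" and A: "c / real K * 3 ^ n \<le> real (card {x \<in> W. to_nat (i, x) \<in> X})"
    by (rule large_section[OF \<open>X \<subseteq> verts T\<close> X K])
  obtain j where j: "j < K" and B: "c / real K * 3 ^ n \<le> real (card {y \<in> W. to_nat (j, y) \<in> Y})"
    by (rule large_section[OF \<open>Y \<subseteq> verts T\<close> Y K])
  define A where "A = {x \<in> W. to_nat (i, x) \<in> X}"
  define B where "B = {y \<in> W. to_nat (j, y) \<in> Y}"
  have sub: "A \<subseteq> W" "B \<subseteq> W" by (auto simp: A_def B_def)
  have rot_sub: "rot ` S \<subseteq> W" and card_rot: "card (rot ` S) = card S" if "S \<subseteq> W" for S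
    using that rot_in_words inj_on_subset[OF inj_on_rot_words] by (auto intro!: card_image)
  note A = A[folded A_def] and B = B[folded B_def]
  have beats: "beats (i, a) (j, b)" if "a \<in> A" "b \<in> B" for a b
  proof -
    have "(i, a) \<in> V" "(j, b) \<in> V" using that i j by (auto simp: V_def A_def B_def)
    moreover have "to_nat (i, a) \<rightarrow>\<^bsub>T\<^esub> to_nat (j, b)"
      using XY that by (auto simp: pure_pair_def A_def B_def)
    ultimately show ?thesis using adj_T by blast
  qed
  consider "i < j" | "j < i" | "i = j" by linarith
  then show False
  proof cases
    case 1
    \<comment> \<open>Here b near \<open>rot a\<close> reverses the edge; \<open>rot\<close>
      preserves the size of A.\<close>
    obtain a b where "a \<in> A" "b \<in> B" "hamming (rot a) b \<le> m"
      using hamming_close[of "rot ` A" B] A B sub rot_sub card_rot by auto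
    then show False using beats[of a b] 1 m_le_thr[of i j] by (simp add: close_def)
  next
    case 2
    \<comment> \<open>Here an edge from a to b needs a near \<open>rot b\<close>, so it suffices
      that a is near b and thus far from \<open>rot b\<close>.\<close>
    obtain a b where ab: "a \<in> A" "b \<in> B" "hamming a b \<le> m"
      using hamming_close[of A B] A B sub by auto
    then have W: "a \<in> W" "b \<in> W" using sub by auto
    have "n = hamming (rot b) b" using W by (simp add: hamming_rot_self(1))
    also have "\<dots> \<le> hamming (rot b) a + hamming a b"
      using W by (intro hamming_triangle_W rot_in_words)
    also have "\<dots> \<le> thr j i + m" using beats[of a b] ab 2 by (simp add: close_def)
    also have "\<dots> \<le> 3 ^ K\<^sup>2 * m + 3 ^ K\<^sup>2 * m" using thr_le[OF 2 i] m_le by (intro add_mono)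
    finally show False using four_thr_less by linarith
  next
    case 3
    \<comment> \<open>Inside a block, a near \<open>rot b\<close> directs the edge from b to
      a.\<close>
    obtain a b where "a \<in> A" "b \<in> B" "hamming (rot b) a \<le> m"
      using hamming_close[of "rot ` B" A] A B sub rot_sub card_rot by auto
    then show False using beats[of a b] 3 not_close_close[of b a] sub by (auto simp: close_def)
  qed
qed

end

section \<open>Counterexamples for every constant\<close>

lemma digraph_P7_minus: "digraph P7_minus"
proof -
  interpret P7: digraph P7 using tournament_P7 by (simp add: tournament_def)
  have "finite (arcs P7_minus)"
    by (rule finite_subset[OF _ P7.finite_arcs]) (auto simp: P7_minus_def pre_digraph.del_vert_def)
  then show ?thesis
    by unfold_locales (auto simp: P7_minus_def pre_digraph.del_vert_def arc_to_ends_def P7_def)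
qed

lemma P7_minus_simps:
  "verts P7_minus = {1, 2, 3, 4, 5, 6}"
  "u \<in> verts P7_minus \<Longrightarrow> v \<in> verts P7_minus \<Longrightarrow> u \<rightarrow>\<^bsub>P7_minus\<^esub> v \<longleftrightarrow> (v - u) mod 7 \<in> {1, 2, 4}"
  by (auto simp: P7_minus_def pre_digraph.del_vert_def P7_def arcs_ends_conv image_iff)

lemma rotation_tournament_counterexample:
  fixes c :: real
  assumes c: "c > 0"
  shows "infinite {n. \<exists>(G :: nat pair_pre_digraph) I B.
    tournament G \<and> card (verts G) = n \<and>
    blockade (verts G) I B \<and> real (blockade_length I) \<ge> 1 / c \<and>
    \<not> (\<exists>X Y. pure_pair G X Y \<and> real (pair_order X Y) \<ge> c * real (blockade_width I B)) \<and>
    \<not> has_rainbow_copy D5 G I B \<and> \<not> has_rainbow_copy P7_minus G I B}" (is "infinite ?N")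
proof -
  \<comment> \<open>The length bound fixes \<open>K\<close>; the density c / K then determines how
    large m must be.\<close>
  define K where "K = nat \<lceil>1 / c\<rceil>"
  have Kc: "1 / c \<le> real K" unfolding K_def by linarith
  have K: "K > 0" using c by (simp add: K_def)
  define L :: nat where "L = 5 * 3 ^ K\<^sup>2"
  define large_sets_close where "large_sets_close m \<longleftrightarrow>
    (\<forall>A B. A \<subseteq> words {..<3::nat} (L * m) \<longrightarrow> B \<subseteq> words {..<3} (L * m) \<longrightarrow>
      c / real K * 3 ^ (L * m) \<le> real (card A) \<longrightarrow> c / real K * 3 ^ (L * m) \<le> real (card B) \<longrightarrow>
      (\<exists>a\<in>A. \<exists>b\<in>B. hamming a b \<le> m))" for m
  have "L > 0" by (simp add: L_def)
  then have "eventually large_sets_close sequentially"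
    using c K by (intro eventually_mono[OF eventually_hamming_close[of "{..<3::nat}" "c / real K" L]])
      (simp_all add: large_sets_close_def lessThan_empty_iff)
  then obtain m0 where m0: "\<And>m. m \<ge> m0 \<Longrightarrow> large_sets_close m"
    unfolding eventually_sequentially by blast
  \<comment> \<open>Starting at \<open>Suc m0\<close> also ensures m > 0, as the locale
    demands.\<close>
  have "K * 3 ^ (L * m) \<in> ?N" if m: "m \<in> {Suc m0..}" for m
  proof -
    interpret rotation_tournament K m "L * m" using m by unfold_locales (auto simp: L_def)
    have "\<not> has_rainbow_copy D5 T I block"
    proof (rule not_has_rainbow_copy_T)
      show "digraph D5" using tournament_D5 by (simp add: tournament_def)
      show "admissible_orderings (\<lambda>i j. (j - i) mod 5 \<in> {1, 2}) [1, 2, 3, 4, 5 :: int]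
        (length [1, 2, 3, 4, 5 :: int]) = []"
        by (rule no_admissible_orderings_D5)
    qed (unfold D5_simps, auto)
    moreover have "\<not> has_rainbow_copy P7_minus T I block"
    proof (rule not_has_rainbow_copy_T)
      show "digraph P7_minus" by (rule digraph_P7_minus)
      show "admissible_orderings (\<lambda>i j. (j - i) mod 7 \<in> {1, 2, 4}) [1, 2, 3, 4, 5, 6 :: int]
        (length [1, 2, 3, 4, 5, 6 :: int]) = []"
        by (rule no_admissible_orderings_P7_minus)
      show "u \<rightarrow>\<^bsub>P7_minus\<^esub> v \<longleftrightarrow> (v - u) mod 7 \<in> {1, 2, 4}"
        if "u \<in> verts P7_minus" "v \<in> verts P7_minus" for u v
        using that by (rule P7_minus_simps(2))
    qed (simp_all add: P7_minus_simps(1))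
    moreover have "\<not> (\<exists>X Y. pure_pair T X Y \<and> c * real (blockade_width I block) \<le> real (pair_order X Y))"
    proof (rule no_large_pure_pair[OF K])
      have "large_sets_close m" using m by (intro m0) simp
      then show "\<exists>a\<in>A. \<exists>b\<in>B. hamming a b \<le> m"
        if "A \<subseteq> W" "B \<subseteq> W" "c / real K * 3 ^ (L * m) \<le> real (card A)"
          "c / real K * 3 ^ (L * m) \<le> real (card B)" for A B
        using that unfolding large_sets_close_def by blast
    qed
    ultimately show ?thesis
      using tournament_T card_verts_T blockade_T blockade_length_T Kc
      by (intro CollectI exI[of _ T] exI[of _ I] exI[of _ block]) simp
  qed
  then have "(\<lambda>m. K * 3 ^ (L * m)) ` {Suc m0..} \<subseteq> ?N" by blast
  \<comment> \<open>Different m give different vertex counts, hence infinitely many of them.\<close>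
  moreover have "inj_on (\<lambda>m. K * 3 ^ (L * m)) {Suc m0..}"
    using K \<open>L > 0\<close> by (auto simp: inj_on_def)
  then have "infinite ((\<lambda>m. K * 3 ^ (L * m)) ` {Suc m0..})"
    using infinite_Ici[of "Suc m0"] by (simp add: finite_image_iff)
  ultimately show ?thesis by (rule infinite_super)
qed

theorem mainTheorem5:
  shows "(\<forall>c::real. c > 0 \<longrightarrow>
            infinite {n. \<exists>(G :: nat pair_pre_digraph) I B.
              tournament G \<and> card (verts G) = n \<and>
              blockade (verts G) I B \<and> real (blockade_length I) \<ge> 1 / c \<and>
              \<not> (\<exists>X Y. pure_pair G X Y \<and> real (pair_order X Y) \<ge> c * real (blockade_width I B)) \<and>
              \<not> has_rainbow_copy D5 G I B \<and> \<not> has_rainbow_copy P7_minus G I B})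
       \<and> \<not> RSEH D5 \<and> \<not> RSEH P7_minus"
proof (intro conjI allI impI)
  \<comment> \<open>To refute the RSEH-property at a constant c, one tournament from the infinite
    family suffices.\<close>
  have ex: "\<exists>(G :: nat pair_pre_digraph) I B.
      tournament G \<and> blockade (verts G) I B \<and> real (blockade_length I) \<ge> 1 / c \<and>
      \<not> (\<exists>X Y. pure_pair G X Y \<and> real (pair_order X Y) \<ge> c * real (blockade_width I B)) \<and>
      \<not> has_rainbow_copy D5 G I B \<and> \<not> has_rainbow_copy P7_minus G I B" if "c > 0" for c :: real
    using infinite_imp_nonempty[OF rotation_tournament_counterexample[OF that]] by blast
  show "\<not> RSEH D5" unfolding RSEH_def using ex by blast
  show "\<not> RSEH P7_minus" unfolding RSEH_def using ex by blast
qed (rule rotation_tournament_counterexample)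

end
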